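(* For every integer $a \ge 3$, the only (up to isomorphism) connected well-hued graph $G$ with $a_1 = a$ and $a_2 = a_1 + 2$ is the corona of a complete graph (that is, of the complete graph $K_a$).
   Context: All graphs are finite and simple. For $k\ge 1$, a maximal $k$-colorable subgraph of $G$ is a subgraph induced by a set $S\subseteq V(G)$ such that $G[S]$ is (properly) $k$-colorable and $G[S']$ is not $k$-colorable for every $S'$ with $S\subsetneq S'\subseteq V(G)$. $G$ is well-hued if for every $k\ge 1$ all maximal $k$-colorable subgraphs of $G$ have the same order, denoted $a_k$. The corona of a graph $H$ is the graph obtained from $H$ by attaching exactly one new pendant (leaf) vertex to each vertex of $H$. *)

theory Defs
  imports "Graph_Theory.Digraph_Isomorphism" "Graph_Theory.Kuratowski"
begin

text \<open>
  Finite simple graphs are the symmetric, loop-free digraphs without parallel arcs of the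
  locale \<^locale>\<open>graph\<close>; an edge is a pair of opposite arcs.
\<close>

definition colorable :: "nat \<Rightarrow> ('a, 'b) pre_digraph \<Rightarrow> bool" where
  "colorable k G \<longleftrightarrow>
    (\<exists>c :: 'a \<Rightarrow> nat. (\<forall>v \<in> verts G. c v < k) \<and> (\<forall>u v. u \<rightarrow>\<^bsub>G\<^esub> v \<longrightarrow> c u \<noteq> c v))"

definition maximal_colorable_subgraph ::
    "nat \<Rightarrow> ('a, 'b) pre_digraph \<Rightarrow> ('a, 'b) pre_digraph \<Rightarrow> bool" where
  "maximal_colorable_subgraph k G H \<longleftrightarrow>
    (\<exists>S. S \<subseteq> verts G \<and> H = G \<restriction> S \<and> colorable k (G \<restriction> S) \<and>
      (\<forall>S'. S \<subset> S' \<and> S' \<subseteq> verts G \<longrightarrow> \<not> colorable k (G \<restriction> S')))"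

definition well_hued :: "('a, 'b) pre_digraph \<Rightarrow> bool" where
  "well_hued G \<longleftrightarrow>
    (\<forall>k \<ge> 1. \<forall>H H'. maximal_colorable_subgraph k G H \<and> maximal_colorable_subgraph k G H' \<longrightarrow>
      card (verts H) = card (verts H'))"

text \<open>
  The number $a_k$. It is only meaningful for a finite well-hued graph and \<open>k \<ge> 1\<close>: a maximal
  \<open>k\<close>-colorable subgraph then exists, and all of them have the same order.
\<close>
definition hue_number :: "('a, 'b) pre_digraph \<Rightarrow> nat \<Rightarrow> nat" where
  "hue_number G k = (THE n. \<exists>H. maximal_colorable_subgraph k G H \<and> card (verts H) = n)"

text \<open>
  The vertices of \<open>H\<close> are tagged with \<^const>\<open>Inl\<close>; \<open>Inr v\<close> is the leaf attached to \<open>v\<close>.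
\<close>
definition corona :: "('a, 'b) pre_digraph \<Rightarrow> ('a + 'a, ('a + 'a) \<times> ('a + 'a)) pre_digraph" where
  "corona H = with_proj \<lparr> pverts = Inl ` verts H \<union> Inr ` verts H,
    parcs = {(Inl u, Inl v) | u v. u \<rightarrow>\<^bsub>H\<^esub> v} \<union>
            {(Inl v, Inr v) | v. v \<in> verts H} \<union> {(Inr v, Inl v) | v. v \<in> verts H} \<rparr>"

lemma graph_corona:
  assumes "graph H"
  shows "graph (corona H)"
proof -
  interpret H: graph H by fact
  let ?V = "Inl ` verts H \<union> Inr ` verts H"
  let ?E = "{(Inl u, Inl v) | u v. u \<rightarrow>\<^bsub>H\<^esub> v} \<union>
            {(Inl v, Inr v) | v. v \<in> verts H} \<union> {(Inr v, Inl v) | v. v \<in> verts H}"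
  have sub: "?E \<subseteq> ?V \<times> ?V"
    by (auto dest: H.adj_in_verts)
  have fin: "finite ?E"
    by (rule finite_subset[OF sub]) simp
  have "pair_graph \<lparr> pverts = ?V, parcs = ?E \<rparr>"
  proof
    show "symmetric (with_proj \<lparr> pverts = ?V, parcs = ?E \<rparr>)"
      by (auto simp: symmetric_def sym_def dest: H.graph_symmetric)
  qed (use sub fin in \<open>auto dest: H.adj_not_same\<close>)
  then show ?thesis
    unfolding corona_def by (rule pair_graph.pair_graphD_graph)
qed

lemma complete_digraph_exists:
  "complete_digraph n (with_proj \<lparr> pverts = {..<n}, parcs = {(u, v). u < n \<and> v < n \<and> u \<noteq> v} \<rparr>)"
  by (auto simp: complete_digraph_pair_def)

end

theory Submission
  imports Defs
begin

text \<open>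
  Extend a stable set to one of size \<open>a\<close>. A stable set dominated by the former is disjoint from the
  latter, and their union is bipartite, so the dominated set has at most two elements; in
  particular claws are excluded. Applied to both sides of a maximal bipartite induced subgraph, this
  leaves only two non-isolated vertices in each color class, hence \<open>a - 2 \<ge> 1\<close> isolated vertices.
  Since an isolated vertex \<open>z\<close> has a neighbour \<open>w\<close> in the graph, the way \<open>w\<close> closes an odd cycle forces
  the four remaining vertices to induce a path \<open>p q r s\<close> with only \<open>q\<close> and \<open>r\<close> adjacent to \<open>w\<close>.
  So the graph contains no induced \<open>2K\<^sub>2\<close> and no induced \<open>C\<^sub>4\<close>, and every vertex has at most one
  neighbour in the stable set formed by the isolated vertices, \<open>p\<close> and \<open>s\<close>. Consequently the complement
  of this set is a clique; two clique vertices with a common neighbour in the stable set would yield a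
  maximal bipartite subgraph with only \<open>a + 1\<close> vertices.
\<close>

section \<open>Stable sets, extension properties and domination\<close>

locale finite_adjacency =
  fixes V :: "'a set" and E :: "'a \<Rightarrow> 'a \<Rightarrow> bool"
  assumes finite_V: "finite V"
    and adj_sym: "E u v \<Longrightarrow> E v u"
    and adj_irrefl: "\<not> E u u"
    and adj_in_V: "E u v \<Longrightarrow> u \<in> V" "E u v \<Longrightarrow> v \<in> V"
begin

definition stable :: "'a set \<Rightarrow> bool" where
  "stable S \<longleftrightarrow> S \<subseteq> V \<and> (\<forall>u\<in>S. \<forall>v\<in>S. \<not> E u v)"

lemma stable_finite: "stable S \<Longrightarrow> finite S"
  using finite_V finite_subset by (auto simp: stable_def)

lemma adj_commute: "E u v \<longleftrightarrow> E v u"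
  using adj_sym by blast

end

text \<open>The consequences of connectedness and of well-huedness for one and two colors, with a
  bipartite set written as a pair of disjoint stable sets. \<open>bipartite_extends\<close>
  preserves only the union, not the classes, because the larger set may need a different
  coloring.\<close>

locale two_hued = finite_adjacency +
  fixes a :: nat
  assumes a_ge_3: "3 \<le> a"
    and no_isolated: "v \<in> V \<Longrightarrow> \<exists>w. E v w"
    and stable_extends: "stable S \<Longrightarrow> \<exists>T. S \<subseteq> T \<and> stable T \<and> card T = a"
    and bipartite_extends: "\<lbrakk>stable X; stable Y; X \<inter> Y = {}\<rbrakk> \<Longrightarrow>
      \<exists>X' Y'. stable X' \<and> stable Y' \<and> X' \<inter> Y' = {} \<and> X \<union> Y \<subseteq> X' \<union> Y' \<and> card X' + card Y' = a + 2"
begin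

lemma stable_card_le: "stable S \<Longrightarrow> card S \<le> a"
  by (metis stable_extends stable_finite card_mono)

lemma bipartite_card_le:
  assumes "stable X" "stable Y" "X \<inter> Y = {}"
  shows "card X + card Y \<le> a + 2"
proof -
  obtain X' Y' where *: "stable X'" "stable Y'" "X' \<inter> Y' = {}" "X \<union> Y \<subseteq> X' \<union> Y'"
      "card X' + card Y' = a + 2"
    using bipartite_extends[OF assms] by blast
  have "card (X \<union> Y) \<le> card (X' \<union> Y')"
    using * stable_finite by (intro card_mono) auto
  then show ?thesis
    using * assms stable_finite by (simp add: card_Un_disjoint)
qed

lemma dominated_card_le_2:
  assumes "stable X" "stable Y" and dom: "\<And>y. y \<in> Y \<Longrightarrow> \<exists>x\<in>X. E y x"
  shows "card Y \<le> 2"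
proof -
  obtain T where T: "X \<subseteq> T" "stable T" "card T = a"
    using stable_extends[OF assms(1)] by blast
  have "T \<inter> Y = {}"
    using T dom unfolding stable_def by blast
  then show ?thesis
    using bipartite_card_le[of T Y] T assms(2) by simp
qed

text \<open>The dominating vertices may coincide: \<open>u = v\<close> gives claw-freeness, while
  \<open>u \<noteq> v\<close> handles triples whose members are attached to two nonadjacent
  vertices.\<close>

lemma no_dominated_triple:
  assumes "u \<in> V" "v \<in> V" "\<not> E u v"
    and "y1 \<noteq> y2" "y1 \<noteq> y3" "y2 \<noteq> y3" "\<not> E y1 y2" "\<not> E y1 y3" "\<not> E y2 y3"
    and "E y1 u \<or> E y1 v" "E y2 u \<or> E y2 v" "E y3 u \<or> E y3 v"
  shows False
proof -
  have "stable {u, v}" "stable {y1, y2, y3}"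
    using assms adj_irrefl adj_in_V by (auto simp: adj_commute stable_def)
  then have "card {y1, y2, y3} \<le> 2"
    using assms by (intro dominated_card_le_2[of "{u, v}"]) auto
  then show False
    using assms by simp
qed

corollary claw_free:
  assumes "E y1 u" "E y2 u" "E y3 u"
    and "y1 \<noteq> y2" "y1 \<noteq> y3" "y2 \<noteq> y3" "\<not> E y1 y2" "\<not> E y1 y3" "\<not> E y2 y3"
  shows False
  using assms no_dominated_triple[of u u y1 y2 y3] adj_irrefl adj_sym adj_in_V by blast

section \<open>Cores: the structure of maximal bipartite subgraphs\<close>

text \<open>The shape of every maximal 2-colorable set; the color classes split \<open>Z\<close> arbitrarily.\<close>
definition core :: "'a \<Rightarrow> 'a \<Rightarrow> 'a \<Rightarrow> 'a \<Rightarrow> 'a set \<Rightarrow> bool" where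
  "core x x' y y' Z \<longleftrightarrow>
    {x, x', y, y'} \<subseteq> V \<and> Z \<subseteq> V \<and> distinct [x, x', y, y'] \<and> Z \<inter> {x, x', y, y'} = {} \<and>
    card Z + 2 = a \<and> \<not> E x x' \<and> \<not> E y y' \<and>
    (E x y \<or> E x y') \<and> (E x' y \<or> E x' y') \<and> (E x y \<or> E x' y) \<and> (E x y' \<or> E x' y') \<and>
    (\<forall>z\<in>Z. \<forall>b\<in>Z \<union> {x, x', y, y'}. \<not> E z b \<and> \<not> E b z)"

text \<open>Together with the next two lemmas: the symmetries of a core, which exchange the classes
  or the members of one class. They reduce later case distinctions to a single labelling.\<close>

lemma core_swap: "core x x' y y' Z \<Longrightarrow> core y y' x x' Z"
  unfolding core_def by (auto simp: adj_commute)

lemma core_swap_left: "core x x' y y' Z \<Longrightarrow> core x' x y y' Z"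
  unfolding core_def by (auto simp: adj_commute)

lemma core_swap_right: "core x x' y y' Z \<Longrightarrow> core x x' y' y Z"
  unfolding core_def by (auto simp: adj_commute)

lemma core_isolated: "\<lbrakk>core x x' y y' Z; z \<in> Z; E z b\<rbrakk> \<Longrightarrow> b \<notin> Z \<union> {x, x', y, y'}"
  unfolding core_def by blast

text \<open>\<open>P\<close> and \<open>Q\<close> collect the vertices of either class with a
  neighbour in the other class, \<open>Z\<close> the rest, which is isolated inside the bipartite
  set. Domination bounds \<open>P\<close> and \<open>Q\<close> by 2; stability bounds
  \<open>P \<union> Z\<close> and \<open>Q \<union> Z\<close> by \<open>a\<close>. Since the three
  cardinalities add up to \<open>a + 2\<close>, they must be 2, 2 and \<open>a - 2\<close>.\<close>

lemma core_exists:
  assumes "stable X" "stable Y" "X \<inter> Y = {}"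
  obtains x x' y y' Z where "core x x' y y' Z" "X \<union> Y \<subseteq> Z \<union> {x, x', y, y'}"
proof -
  obtain X' Y' where B: "stable X'" "stable Y'" "X' \<inter> Y' = {}" "X \<union> Y \<subseteq> X' \<union> Y'"
      "card X' + card Y' = a + 2"
    using bipartite_extends[OF assms] by blast
  define P where "P = {x \<in> X'. \<exists>y\<in>Y'. E x y}"
  define Q where "Q = {y \<in> Y'. \<exists>x\<in>X'. E y x}"
  define Z where "Z = (X' - P) \<union> (Y' - Q)"
  have st: "stable P" "stable Q" "stable (P \<union> Z)" "stable (Q \<union> Z)"
    using B adj_sym unfolding P_def Q_def Z_def stable_def by blast+
  have dj: "P \<inter> Z = {}" "Q \<inter> Z = {}" "P \<inter> Q = {}"
    using B unfolding P_def Q_def Z_def by auto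
  have fin: "finite X'" "finite Y'" "finite P" "finite Q" "finite Z"
    using B st stable_finite by auto
  have "card P \<le> 2"
    using B adj_sym unfolding P_def
    by (intro dominated_card_le_2[of Y']) (auto simp: stable_def)
  moreover have "card Q \<le> 2"
    using B adj_sym unfolding Q_def
    by (intro dominated_card_le_2[of X']) (auto simp: stable_def)
  moreover have "card P + card Z \<le> a" "card Q + card Z \<le> a"
    using stable_card_le[OF st(3)] stable_card_le[OF st(4)] dj fin by (simp_all add: card_Un_disjoint)
  moreover have "card P + card Q + card Z = a + 2"
  proof -
    have "X' \<union> Y' = P \<union> Q \<union> Z"
      unfolding P_def Q_def Z_def by auto
    then have "card X' + card Y' = card (P \<union> Q \<union> Z)"
      using B fin card_Un_disjoint by metis
    also have "\<dots> = card P + card Q + card Z"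
      using dj fin by (subst card_Un_disjoint, auto simp: card_Un_disjoint)+
    finally show ?thesis
      using B by simp
  qed
  ultimately have cards: "card P = 2" "card Q = 2" "card Z + 2 = a"
    by linarith+
  obtain x x' where x: "P = {x, x'}" "x \<noteq> x'"
    using cards(1) by (meson card_2_iff)
  obtain y y' where y: "Q = {y, y'}" "y \<noteq> y'"
    using cards(2) by (meson card_2_iff)
  have PQ: "\<exists>q\<in>Q. E p q" if "p \<in> P" for p
    using that adj_sym unfolding P_def Q_def by blast
  have QP: "\<exists>p\<in>P. E p q" if "q \<in> Q" for q
    using that adj_sym unfolding P_def Q_def by blast
  have "core x x' y y' Z"
    unfolding core_def
    using x y st dj cards PQ[of x] PQ[of x'] QP[of y] QP[of y'] by (auto simp: stable_def)
  moreover have "X \<union> Y \<subseteq> Z \<union> {x, x', y, y'}"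
    using B(4) x y unfolding Z_def by auto
  ultimately show thesis
    by (rule that)
qed

text \<open>Otherwise \<open>{w, x, x'}\<close> and \<open>Z \<union> {y, y'}\<close> would be
  disjoint stable sets with \<open>3 + a\<close> vertices in total.\<close>

lemma core_outside_neighbour:
  assumes c: "core x x' y y' Z" and w: "w \<in> V" "w \<notin> Z \<union> {x, x', y, y'}"
  shows "E w x \<or> E w x'"
proof (rule ccontr)
  assume n: "\<not> (E w x \<or> E w x')"
  have "finite Z"
    using c finite_V finite_subset by (auto simp: core_def)
  moreover have "stable {w, x, x'}" "stable (Z \<union> {y, y'})"
    using c w n adj_irrefl unfolding core_def stable_def by (auto simp: adj_commute)
  moreover have "{w, x, x'} \<inter> (Z \<union> {y, y'}) = {}"
    using c w by (auto simp: core_def)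
  ultimately have "card {w, x, x'} + card (Z \<union> {y, y'}) \<le> a + 2"
    by (intro bipartite_card_le)
  moreover have "card {w, x, x'} = 3"
    using c w by (auto simp: core_def)
  moreover have "card (Z \<union> {y, y'}) = a"
    using c \<open>finite Z\<close> by (subst card_Un_disjoint) (auto simp: core_def)
  ultimately show False
    by simp
qed

text \<open>The four vertices induce the path \<open>p q r s\<close>. Alternate vertices of a path
  share a color, hence the argument order \<open>p r q s\<close> of \<open>core\<close>, which
  supplies the non-edges \<open>p r\<close> and \<open>q s\<close>.\<close>

definition path_core :: "'a \<Rightarrow> 'a \<Rightarrow> 'a \<Rightarrow> 'a \<Rightarrow> 'a set \<Rightarrow> bool" where
  "path_core p q r s Z \<longleftrightarrow> core p r q s Z \<and> E p q \<and> E q r \<and> E r s \<and> \<not> E p s"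

lemma path_core_distinct: "path_core p q r s Z \<Longrightarrow> distinct [p, q, r, s]"
  by (auto simp: path_core_def core_def)

text \<open>A neighbour \<open>w\<close> of \<open>z\<close> is the center of potential claws with
  leg \<open>z\<close>: they force the edge \<open>x y\<close> and forbid the edge
  \<open>w x'\<close>. An edge \<open>x' y'\<close> would then let the nonadjacent pair
  \<open>w, x'\<close> dominate the stable triple \<open>z, y, y'\<close>. With \<open>x' y'\<close>
  excluded, the conditions in \<open>core\<close> supply the remaining edges of the path
  \<open>x' y x y'\<close>.\<close>

lemma core_is_path_aux:
  assumes c: "core x x' y y' Z" and w: "w \<in> V" "w \<notin> Z \<union> {x, x', y, y'}"
    and z: "z \<in> Z" "E w z" and xy: "E w x" "E w y"
  shows "path_core x' y x y' Z"
proof -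
  note [simp] = adj_irrefl
  have zn: "\<not> E z x" "\<not> E z x'" "\<not> E z y" "\<not> E z y'"
      "z \<noteq> x" "z \<noteq> x'" "z \<noteq> y" "z \<noteq> y'"
    using c z by (auto simp: core_def)
  note d = c[unfolded core_def]
  have "E x y"
    using claw_free[of z w x y] d zn z xy by (auto simp: adj_commute)
  have nx': "\<not> E w x'"
    using claw_free[of z w x x'] d zn z xy by (auto simp: adj_commute)
  have "\<not> E x' y'"
  proof
    assume "E x' y'"
    then show False
      using no_dominated_triple[of w x' z y y'] d zn z xy nx' w by (auto simp: adj_commute)
  qed
  then show ?thesis
    using d \<open>E x y\<close> core_swap_left[OF c] unfolding path_core_def by (auto simp: adj_commute)
qed

lemma core_is_path:
  assumes c: "core x x' y y' Z"
  obtains p q r s where "path_core p q r s Z" "{p, q, r, s} = {x, x', y, y'}"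
proof -
  \<comment> \<open>\<open>card Z = a - 2\<close> is positive because \<open>a\<close> is at least
    3. A neighbour \<open>w\<close> of some \<open>z\<close> in \<open>Z\<close> lies outside the
    core and hence meets both classes; the four ways of meeting them are relabellings of one
    case.\<close>
  have "Z \<noteq> {}"
    using c a_ge_3 by (auto simp: core_def)
  then obtain z where z: "z \<in> Z"
    by blast
  then obtain w where w: "E w z"
    using no_isolated[of z] c by (auto simp: adj_commute core_def)
  then have wV: "w \<in> V" "w \<notin> Z \<union> {x, x', y, y'}"
    using z c adj_in_V by (auto simp: adj_commute core_def)
  have "E w x \<or> E w x'"
    by (rule core_outside_neighbour[OF c wV])
  moreover have "E w y \<or> E w y'"
    by (rule core_outside_neighbour[OF core_swap[OF c] wV(1)]) (use wV(2) in auto)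
  ultimately consider "E w x" "E w y" | "E w x" "E w y'" | "E w x'" "E w y" | "E w x'" "E w y'"
    by blast
  then show thesis
  proof cases
    case 1
    show ?thesis
      by (rule that[OF core_is_path_aux[OF c wV z w 1]]) auto
  next
    case 2
    show ?thesis
      by (rule that[OF core_is_path_aux[OF core_swap_right[OF c] _ _ z w 2]]) (use wV in auto)
  next
    case 3
    show ?thesis
      by (rule that[OF core_is_path_aux[OF core_swap_left[OF c] _ _ z w 3]]) (use wV in auto)
  next
    case 4
    show ?thesis
      by (rule that[OF core_is_path_aux[OF core_swap_left[OF core_swap_right[OF c]] _ _ z w 4]]) (use wV in auto)
  qed
qed

section \<open>Excluding induced 2K2 and C4\<close>

text \<open>An induced 2K2 is bipartite, and none of its vertices is isolated, so in any core
  containing it these are the four non-isolated vertices. Those induce a path, whose inner vertex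
  \<open>q\<close> has two neighbours, whereas 2K2 has maximum degree 1.\<close>

lemma two_K2_free:
  assumes "E x y" "E x' y'" "\<not> E x x'" "\<not> E y y'" "\<not> E x y'" "\<not> E x' y"
  shows False
proof -
  have "stable {x, x'}" "stable {y, y'}" "{x, x'} \<inter> {y, y'} = {}"
    using assms adj_irrefl adj_in_V by (auto simp: adj_commute stable_def)
  then obtain u u' v v' Z where c: "core u u' v v' Z" "{x, x'} \<union> {y, y'} \<subseteq> Z \<union> {u, u', v, v'}"
    by (rule core_exists)
  have d: "distinct [x, x', y, y']"
    using assms adj_irrefl by (auto simp: adj_commute)
  have "{x, x', y, y'} \<inter> Z = {}"
    using c(2) core_isolated[OF c(1)] assms(1-4) adj_sym by blast
  then have sub: "{x, x', y, y'} \<subseteq> {u, u', v, v'}"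
    using c by auto
  obtain p q r s where P: "path_core p q r s Z" "{p, q, r, s} = {u, u', v, v'}"
    using core_is_path[OF c(1)] by blast
  have "{x, x', y, y'} = {p, q, r, s}"
    using sub[folded P(2)] path_core_distinct[OF P(1)] d by (intro card_subset_eq) auto
  then have "q \<in> {x, x', y, y'}" "p \<in> {x, x', y, y'}" "r \<in> {x, x', y, y'}"
    by auto
  moreover have "p \<noteq> r" "E q p" "E q r"
    using P(1) adj_sym unfolding path_core_def core_def by auto
  moreover have "v = v'" if "v \<in> {x, x', y, y'}" "v' \<in> {x, x', y, y'}" "u \<in> {x, x', y, y'}" "E u v" "E u v'" for u v v'
    using that assms adj_sym adj_irrefl by blast
  ultimately show False
    by blast
qed

text \<open>As for 2K2, the four vertices would be those of a path core; now the end
  \<open>p\<close> has a single neighbour among them, but every vertex of a 4-cycle has two.\<close>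

lemma C4_free:
  assumes "E x y" "E x y'" "E x' y" "E x' y'" "\<not> E x x'" "\<not> E y y'" "x \<noteq> x'" "y \<noteq> y'"
  shows False
proof -
  have "stable {x, x'}" "stable {y, y'}" "{x, x'} \<inter> {y, y'} = {}"
    using assms adj_irrefl adj_in_V by (auto simp: adj_commute stable_def)
  then obtain u u' v v' Z where c: "core u u' v v' Z" "{x, x'} \<union> {y, y'} \<subseteq> Z \<union> {u, u', v, v'}"
    by (rule core_exists)
  have d: "distinct [x, x', y, y']"
    using assms adj_irrefl by (auto simp: adj_commute)
  have "{x, x', y, y'} \<inter> Z = {}"
    using c(2) core_isolated[OF c(1)] assms(1-4) adj_sym by blast
  then have sub: "{x, x', y, y'} \<subseteq> {u, u', v, v'}"
    using c by auto
  obtain p q r s where P: "path_core p q r s Z" "{p, q, r, s} = {u, u', v, v'}"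
    using core_is_path[OF c(1)] by blast
  have eq: "{x, x', y, y'} = {p, q, r, s}"
    using sub[folded P(2)] path_core_distinct[OF P(1)] d by (intro card_subset_eq) auto
  have "p \<in> {x, x', y, y'}"
    using eq by auto
  then obtain b b' where "b \<in> {p, q, r, s}" "b' \<in> {p, q, r, s}" "b \<noteq> b'" "E p b" "E p b'"
    unfolding eq[symmetric] using assms adj_sym by blast
  moreover have "b = q" if "b \<in> {p, q, r, s}" "E p b" for b
    using that P(1) adj_irrefl unfolding path_core_def core_def by blast
  ultimately show False
    by blast
qed

section \<open>Reconstructing leaves and clique\<close>

lemma stable_neighbour:
  assumes "stable I" "card I = a" "c \<in> V - I"
  shows "\<exists>i\<in>I. E c i"
proof (rule ccontr)
  assume "\<not> ?thesis"
  then have "stable (insert c I)"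
    using assms adj_irrefl by (auto simp: adj_commute stable_def)
  then show False
    using stable_card_le[of "insert c I"] assms stable_finite by simp
qed

text \<open>The set is \<open>Z\<close> together with the two ends of a path core. The color class
  \<open>{p, r}\<close> in place of \<open>{p, s}\<close> would fail, since \<open>q\<close> is
  adjacent to both \<open>p\<close> and \<open>r\<close>.\<close>

lemma private_stable_exists:
  obtains I where "stable I" "card I = a" "\<And>c i j. \<lbrakk>i \<in> I; j \<in> I; E c i; E c j\<rbrakk> \<Longrightarrow> i = j"
proof -
  have "stable {}"
    by (auto simp: stable_def)
  then obtain x x' y y' Z where "core x x' y y' Z"
    using core_exists[of "{}" "{}"] by (metis inf_bot_left)
  then obtain p q r s where P: "path_core p q r s Z"
    by (rule core_is_path)
  then have c: "core p r q s Z"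
    by (simp add: path_core_def)
  note d = P[unfolded path_core_def core_def]
  let ?I = "Z \<union> {p, s}"
  have finZ: "finite Z"
    using d finite_V finite_subset by auto
  have I: "stable ?I" "card ?I = a"
    using d adj_irrefl finZ by (auto simp: adj_commute stable_def)
  have Zout: "E w q \<and> E w r \<and> \<not> E w p \<and> \<not> E w s \<and> (\<forall>z'\<in>Z. E w z' \<longrightarrow> z' = z)"
    if "z \<in> Z" "E w z" for w z
  proof -
    have w: "w \<in> V" "w \<notin> Z \<union> {p, r, q, s}"
      using that d adj_in_V by (auto simp: adj_commute)
    have "E w p \<or> E w r" "E w q \<or> E w s"
      using core_outside_neighbour[OF c w] core_outside_neighbour[OF core_swap[OF c]] w by auto
    have zn: "\<not> E z p" "\<not> E z q" "\<not> E z r" "\<not> E z s" "z \<noteq> p" "z \<noteq> q" "z \<noteq> r" "z \<noteq> s"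
      using d that by auto
    \<comment> \<open>With \<open>z\<close> as one leg of a claw centered at \<open>w\<close>, any
      two other neighbours of \<open>w\<close> that miss \<open>z\<close> must be adjacent.\<close>
    have nonadj: "x = y \<or> E x y" if "E w x" "E w y" "x \<noteq> z" "\<not> E z x" "y \<noteq> z" "\<not> E z y" for x y
      using claw_free[of z w x y] that \<open>E w z\<close> adj_sym by metis
    \<comment> \<open>If \<open>w\<close> were adjacent to \<open>p\<close>, it would miss
      \<open>r\<close> and \<open>s\<close>, and the nonadjacent pair \<open>w, r\<close> would
      dominate the stable triple \<open>z, p, s\<close>. Reversing the path gives the same for
      \<open>s\<close>.\<close>
    have np: "\<not> E w p"
    proof
      assume "E w p"
      then have "\<not> E w r" "\<not> E w s"
        using nonadj[of p r] nonadj[of p s] zn d by auto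
      then show False
        using no_dominated_triple[of w r z p s] w zn d \<open>E w z\<close> \<open>E w p\<close> by (auto simp: adj_commute)
    qed
    moreover have ns: "\<not> E w s"
    proof
      assume "E w s"
      then have "\<not> E w q" "\<not> E w p"
        using nonadj[of s q] nonadj[of p s] zn d by (auto simp: adj_commute)
      then show False
        using no_dominated_triple[of w q z s p] w zn d \<open>E w z\<close> \<open>E w s\<close> by (auto simp: adj_commute)
    qed
    ultimately have "E w q" "E w r"
      using \<open>E w p \<or> E w r\<close> \<open>E w q \<or> E w s\<close> by auto
    moreover have "z' = z" if "z' \<in> Z" "E w z'" for z'
      using claw_free[of z w z' q] that \<open>z \<in> Z\<close> \<open>E w z\<close> \<open>E w q\<close> d by (auto simp: adj_commute)
    ultimately show ?thesis
      using np ns by blast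
  qed
  \<comment> \<open>A common neighbour \<open>u\<close> of both ends misses \<open>z\<close> by
    \<open>Zout\<close>. Excluding 2K2 on \<open>u p\<close> and \<open>w z\<close> then forces the
    edge \<open>u w\<close>, and \<open>p, s, w\<close> become the legs of a claw at
    \<open>u\<close>.\<close>
  have ps: False if "E u p" "E u s" for u
  proof -
    obtain z where z: "z \<in> Z"
      using d a_ge_3 by fastforce
    then obtain w where w: "E w z"
      using no_isolated[of z] d by (auto simp: adj_commute)
    note wz = Zout[OF z w]
    have "\<not> E u z"
      using Zout[OF z] that by blast
    have "E u w"
      using two_K2_free[of u p w z] that w wz z d \<open>\<not> E u z\<close> adj_sym by blast
    then show False
      using claw_free[of p u s w] that w wz z d adj_sym by metis
  qed
  have "i = j" if "i \<in> ?I" "j \<in> ?I" "E u i" "E u j" for u i j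
    using that Zout[of i u] Zout[of j u] ps[of u] by blast
  with I show thesis
    by (rule that)
qed

text \<open>This is a corona in disguise: \<open>I\<close> holds the leaves, its complement is the
  clique, and \<open>f\<close> sends each leaf to its only neighbour.\<close>

lemma corona_structure:
  obtains I f where "stable I" "card I = a" "bij_betw f I (V - I)"
    "\<And>u v. \<lbrakk>u \<in> I; v \<in> I\<rbrakk> \<Longrightarrow> E u (f v) \<longleftrightarrow> u = v"
    "\<And>u v. \<lbrakk>u \<in> I; v \<in> I\<rbrakk> \<Longrightarrow> E (f u) (f v) \<longleftrightarrow> u \<noteq> v"
proof -
  obtain I where I: "stable I" "card I = a"
    and priv: "\<And>c i j. \<lbrakk>i \<in> I; j \<in> I; E c i; E c j\<rbrakk> \<Longrightarrow> i = j"
    by (rule private_stable_exists) blast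
  have IV: "I \<subseteq> V" and nI: "\<And>i j. \<lbrakk>i \<in> I; j \<in> I\<rbrakk> \<Longrightarrow> \<not> E i j"
    using I by (auto simp: stable_def)
  have nb: "\<exists>c\<in>V - I. E i c" if "i \<in> I" for i
    using no_isolated[of i] that IV nI adj_sym adj_in_V by blast
  have clique: "E c c'" if c: "c \<in> V - I" "c' \<in> V - I" "c \<noteq> c'" for c c'
  proof (rule ccontr)
    assume n: "\<not> E c c'"
    obtain i i' where i: "i \<in> I" "E c i" "i' \<in> I" "E c' i'"
      using stable_neighbour[OF I] c by meson
    \<comment> \<open>Distinct neighbours \<open>i\<close>, \<open>i'\<close> give an induced 2K2.
      If they coincide, a neighbour \<open>d\<close> of another \<open>j\<close> in \<open>I\<close>
      must be adjacent to \<open>c\<close> and \<open>c'\<close>, again by excluding 2K2, and then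
      \<open>c i c' d\<close> is an induced C4.\<close>
    show False
    proof (cases "i = i'")
      case False
      then show False
        using two_K2_free[of c i c' i'] i n nI priv by blast
    next
      case True
      have "\<not> I \<subseteq> {i}"
        using I a_ge_3 card_mono[of "{i}" I] by auto
      then obtain j where j: "j \<in> I" "j \<noteq> i"
        by blast
      then obtain d where d: "d \<in> V - I" "E d j"
        using nb adj_sym by blast
      have "\<not> E d i"
        using priv[of i j d] i j d by blast
      have "E c d" "E c' d"
        using two_K2_free[of c i d j] two_K2_free[of c' i d j] i True j d priv nI \<open>\<not> E d i\<close> by blast+
      then show False
        using C4_free[of c i d c'] i True n \<open>\<not> E d i\<close> c d adj_sym by blast
    qed
  qed
  have uniq: "c = c'" if c: "c \<in> V - I" "c' \<in> V - I" "E i c" "E i c'" "i \<in> I" for c c' i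
  proof (rule ccontr)
    assume ne: "c \<noteq> c'"
    have nc: "\<not> E c j" "\<not> E c' j" if "j \<in> I - {i}" for j
      using priv[of i j c] priv[of i j c'] c that by (auto simp: adj_commute)
    \<comment> \<open>\<open>i\<close> is the only neighbour of \<open>c\<close> in
      \<open>I\<close>, so this is a stable set. Together with \<open>c'\<close> it forms a
      bipartite set of only \<open>a + 1\<close> vertices, which must therefore extend by some
      \<open>t\<close>.\<close>
    have "stable (insert c (I - {i}))" "stable {c'}" "insert c (I - {i}) \<inter> {c'} = {}"
      using I c ne nc adj_irrefl by (auto simp: adj_commute stable_def)
    then obtain X Y where B: "stable X" "stable Y" "X \<inter> Y = {}"
        "insert c (I - {i}) \<union> {c'} \<subseteq> X \<union> Y" "card X + card Y = a + 2"
      using bipartite_extends by meson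
    have "card (insert c (I - {i}) \<union> {c'}) = a + 1"
      using I c ne a_ge_3 stable_finite[OF I(1)] by auto
    moreover have "card (X \<union> Y) = a + 2"
      using B stable_finite by (simp add: card_Un_disjoint)
    ultimately have "X \<union> Y \<noteq> insert c (I - {i}) \<union> {c'}"
      by auto
    then obtain t where t: "t \<in> X \<union> Y" "t \<notin> insert c (I - {i}) \<union> {c'}"
      using B(4) by blast
    \<comment> \<open>\<open>t\<close> is either \<open>i\<close> or a further clique vertex, so
      \<open>t, c, c'\<close> is a triangle; two of its vertices fall into the same stable
      class.\<close>
    have "E t c" "E t c'"
      using t c clique B(1,2) adj_sym unfolding stable_def by blast+
    moreover have "E c c'"
      using clique c ne by blast
    moreover have "\<not> E u v" if "{u, v} \<subseteq> X \<or> {u, v} \<subseteq> Y" for u v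
      using that B(1,2) unfolding stable_def by blast
    moreover have "t \<in> X \<or> t \<in> Y" "c \<in> X \<or> c \<in> Y" "c' \<in> X \<or> c' \<in> Y"
      using t(1) B(4) by auto
    ultimately show False
      by (metis empty_subsetI insert_subset)
  qed
  define f where "f i = (SOME c. c \<in> V - I \<and> E i c)" for i
  have f: "f i \<in> V - I \<and> E i (f i)" if "i \<in> I" for i
    unfolding f_def by (rule someI_ex) (use nb[OF that] in blast)
  have inj: "inj_on f I"
    using f priv adj_sym by (metis inj_onI)
  moreover have "f ` I = V - I"
  proof
    show "f ` I \<subseteq> V - I"
      using f by blast
    \<comment> \<open>A vertex outside \<open>I\<close> has some neighbour \<open>i\<close> in
      \<open>I\<close>, and by \<open>uniq\<close> the chosen \<open>f i\<close> can only be that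
      vertex.\<close>
    show "V - I \<subseteq> f ` I"
      using stable_neighbour[OF I] uniq f adj_sym by (metis image_eqI subsetI)
  qed
  ultimately have "bij_betw f I (V - I)"
    by (simp add: bij_betw_def)
  moreover have "E u (f v) \<longleftrightarrow> u = v" if "u \<in> I" "v \<in> I" for u v
    using f priv that adj_sym by metis
  moreover have "E (f u) (f v) \<longleftrightarrow> u \<noteq> v" if "u \<in> I" "v \<in> I" for u v
    using f clique that adj_irrefl inj_onD[OF inj] by metis
  ultimately show thesis
    using that I by blast
qed

end

section \<open>Colorability of induced subgraphs and hue numbers\<close>

lemma dominates_induce_iff: "u \<rightarrow>\<^bsub>G \<restriction> S\<^esub> v \<longleftrightarrow> u \<in> S \<and> v \<in> S \<and> u \<rightarrow>\<^bsub>G\<^esub> v"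
  by (auto simp: arcs_ends_conv)

lemma colorable_induce_iff:
  "colorable k (G \<restriction> S) \<longleftrightarrow>
    (\<exists>c. (\<forall>v\<in>S. c v < k) \<and> (\<forall>u\<in>S. \<forall>v\<in>S. u \<rightarrow>\<^bsub>G\<^esub> v \<longrightarrow> c u \<noteq> c v))"
  unfolding colorable_def dominates_induce_iff by auto

text \<open>Maximality is reduced to adding a single vertex, the form in which it is applied to the
  corona.\<close>

lemma maximal_colorableD:
  assumes "maximal_colorable_subgraph k G H"
  shows "\<exists>S \<subseteq> verts G. H = G \<restriction> S \<and> colorable k (G \<restriction> S) \<and>
    (\<forall>v \<in> verts G. colorable k (G \<restriction> insert v S) \<longrightarrow> v \<in> S)"
proof -
  obtain S where "S \<subseteq> verts G \<and> H = G \<restriction> S \<and> colorable k (G \<restriction> S) \<and>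
      (\<forall>S'. S \<subset> S' \<and> S' \<subseteq> verts G \<longrightarrow> \<not> colorable k (G \<restriction> S'))"
    using assms unfolding maximal_colorable_subgraph_def by (rule exE)
  then have S: "S \<subseteq> verts G" "H = G \<restriction> S" "colorable k (G \<restriction> S)"
    and max: "\<And>S'. \<lbrakk>S \<subset> S'; S' \<subseteq> verts G\<rbrakk> \<Longrightarrow> \<not> colorable k (G \<restriction> S')"
    by simp_all
  have "v \<in> S" if v: "v \<in> verts G" "colorable k (G \<restriction> insert v S)" for v
  proof (rule ccontr)
    assume "v \<notin> S"
    then have "S \<subset> insert v S" "insert v S \<subseteq> verts G"
      using S(1) v(1) by auto
    then show False
      using max v(2) by simp
  qed
  then show ?thesis
    by (intro exI[of _ S]) (simp add: S)
qed

context fin_digraph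
begin

lemma maximal_colorable_extends:
  assumes "S \<subseteq> verts G" "colorable k (G \<restriction> S)"
  obtains T where "S \<subseteq> T" "T \<subseteq> verts G" "maximal_colorable_subgraph k G (G \<restriction> T)"
    "colorable k (G \<restriction> T)"
proof -
  let ?F = "{T. S \<subseteq> T \<and> T \<subseteq> verts G \<and> colorable k (G \<restriction> T)}"
  have "?F \<subseteq> Pow (verts G)"
    by auto
  then have "finite ?F"
    by (rule finite_subset) simp
  moreover have "S \<in> ?F"
    using assms by simp
  ultimately obtain T where T: "T \<in> ?F" "\<And>T'. T' \<in> ?F \<Longrightarrow> T \<subseteq> T' \<Longrightarrow> T = T'"
    by (meson finite_has_maximal2)
  have sub: "S \<subseteq> T" "T \<subseteq> verts G" "colorable k (G \<restriction> T)"
    using T(1) by simp_all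
  have "\<not> colorable k (G \<restriction> T')" if "T \<subset> T'" "T' \<subseteq> verts G" for T'
    using T(2)[of T'] that sub(1) by auto
  then have "maximal_colorable_subgraph k G (G \<restriction> T)"
    unfolding maximal_colorable_subgraph_def by (intro exI[of _ T]) (simp add: sub)
  with sub show thesis
    using that by simp
qed

text \<open>Provides the existence on which the definite description in \<open>hue_number\<close>
  depends.\<close>

lemma maximal_colorable_exists: "\<exists>H. maximal_colorable_subgraph k G H"
proof -
  have "colorable k (G \<restriction> {})"
    by (simp add: colorable_induce_iff)
  then show ?thesis
    using maximal_colorable_extends[of "{}" k] by auto
qed

lemma hue_numberI:
  assumes "\<And>H. maximal_colorable_subgraph k G H \<Longrightarrow> card (verts H) = n"
  shows "hue_number G k = n"
  unfolding hue_number_def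
proof (rule the_equality)
  show "\<exists>H. maximal_colorable_subgraph k G H \<and> card (verts H) = n"
    using maximal_colorable_exists[of k] assms by blast
next
  fix m assume "\<exists>H. maximal_colorable_subgraph k G H \<and> card (verts H) = m"
  then show "m = n"
    using assms by blast
qed

lemma hue_number_eq:
  assumes "well_hued G" "1 \<le> k" "maximal_colorable_subgraph k G H"
  shows "card (verts H) = hue_number G k"
proof (rule hue_numberI[symmetric])
  fix H' assume "maximal_colorable_subgraph k G H'"
  then show "card (verts H') = card (verts H)"
    using assms unfolding well_hued_def by blast
qed

end

section \<open>From well-hued graphs to the extension properties\<close>

lemma colorable_1_iff:
  "colorable 1 (G \<restriction> S) \<longleftrightarrow> (\<forall>u\<in>S. \<forall>v\<in>S. \<not> u \<rightarrow>\<^bsub>G\<^esub> v)"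
proof
  assume "colorable 1 (G \<restriction> S)"
  then show "\<forall>u\<in>S. \<forall>v\<in>S. \<not> u \<rightarrow>\<^bsub>G\<^esub> v"
    unfolding colorable_induce_iff by fastforce
next
  assume "\<forall>u\<in>S. \<forall>v\<in>S. \<not> u \<rightarrow>\<^bsub>G\<^esub> v"
  then show "colorable 1 (G \<restriction> S)"
    unfolding colorable_induce_iff by (intro exI[of _ "\<lambda>_. 0"]) simp
qed

lemma two_hued_graph:
  assumes "graph G" "connected G" "well_hued G" "3 \<le> hue_number G 1"
    and hue2: "hue_number G 2 = hue_number G 1 + 2"
  shows "two_hued (verts G) (\<lambda>u v. u \<rightarrow>\<^bsub>G\<^esub> v) (hue_number G 1)"
proof -
  interpret G: graph G by fact
  interpret finite_adjacency "verts G" "\<lambda>u v. u \<rightarrow>\<^bsub>G\<^esub> v"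
    by unfold_locales (auto dest: G.graph_symmetric G.adj_not_same G.adj_in_verts)
  have stable_iff: "stable S \<longleftrightarrow> S \<subseteq> verts G \<and> colorable 1 (G \<restriction> S)" for S
    unfolding stable_def colorable_1_iff by blast
  have ext1: "\<exists>T. S \<subseteq> T \<and> stable T \<and> card T = hue_number G 1" if S: "stable S" for S
  proof -
    obtain T where T: "S \<subseteq> T" "T \<subseteq> verts G" "maximal_colorable_subgraph 1 G (G \<restriction> T)"
        "colorable 1 (G \<restriction> T)"
      using G.maximal_colorable_extends S unfolding stable_iff by metis
    then show ?thesis
      using G.hue_number_eq[OF assms(3) _ T(3)] stable_iff by auto
  qed
  show ?thesis
  proof
    show "3 \<le> hue_number G 1" by fact
  next
    fix v assume v: "v \<in> verts G"
    \<comment> \<open>A stable set of at least three vertices contains some \<open>u\<close> other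
      than \<open>v\<close>; the first arc of a walk from \<open>v\<close> to \<open>u\<close> gives
      the neighbour.\<close>
    obtain T where "stable T" "card T = hue_number G 1"
      using ext1[of "{}"] by (auto simp: stable_def)
    then have "T \<subseteq> verts G" "\<not> T \<subseteq> {v}"
      using assms(4) card_mono[of "{v}" T] by (auto simp: stable_def)
    then obtain u where u: "u \<in> verts G" "u \<noteq> v"
      by blast
    have "v \<rightarrow>\<^sup>*\<^bsub>G\<^esub> u"
      using G.symmetric_connected_imp_strongly_connected[OF G.sym_arcs assms(2)] u v by blast
    then show "\<exists>w. v \<rightarrow>\<^bsub>G\<^esub> w"
      using u(2) by (cases rule: G.converse_reachable_cases) auto
  next
    fix S assume "stable S"
    then show "\<exists>T. S \<subseteq> T \<and> stable T \<and> card T = hue_number G 1"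
      by (rule ext1)
  next
    fix X Y assume X: "stable X" and Y: "stable Y" and XY: "X \<inter> Y = {}"
    have "colorable 2 (G \<restriction> (X \<union> Y))"
      unfolding colorable_induce_iff
      using X Y XY unfolding stable_def
      by (intro exI[of _ "\<lambda>v. if v \<in> X then 0 else 1"]) auto
    moreover have "X \<union> Y \<subseteq> verts G"
      using X Y by (simp add: stable_def)
    ultimately obtain T where T: "X \<union> Y \<subseteq> T" "T \<subseteq> verts G"
        "maximal_colorable_subgraph 2 G (G \<restriction> T)" "colorable 2 (G \<restriction> T)"
      using G.maximal_colorable_extends by metis
    obtain c where c: "\<forall>v\<in>T. c v < (2::nat)" "\<forall>u\<in>T. \<forall>v\<in>T. u \<rightarrow>\<^bsub>G\<^esub> v \<longrightarrow> c u \<noteq> c v"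
      using T(4) unfolding colorable_induce_iff by blast
    let ?X = "{v \<in> T. c v = 0}" and ?Y = "{v \<in> T. c v \<noteq> 0}"
    \<comment> \<open>With colors below 2, nonzero means 1, so \<open>?X\<close> and
      \<open>?Y\<close> are exactly the two color classes.\<close>
    have "\<not> u \<rightarrow>\<^bsub>G\<^esub> v" if "u \<in> T" "v \<in> T" "c u = 0 \<longleftrightarrow> c v = 0" for u v
    proof -
      have "c u < 2" "c v < 2"
        using c(1) that by simp_all
      then have "c u = c v"
        using that(3) by linarith
      then show ?thesis
        using c(2) that(1,2) by blast
    qed
    then have "stable ?X" "stable ?Y"
      using T(2) unfolding stable_def by auto
    moreover have "finite T"
      using T(2) finite_V by (rule finite_subset)
    then have "card ?X + card ?Y = card (?X \<union> ?Y)"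
      by (intro card_Un_disjoint[symmetric]) auto
    moreover have "?X \<union> ?Y = T"
      by auto
    moreover have "card T = hue_number G 1 + 2"
      using G.hue_number_eq[OF assms(3) _ T(3)] hue2 by simp
    ultimately show "\<exists>X' Y'. stable X' \<and> stable Y' \<and> X' \<inter> Y' = {} \<and> X \<union> Y \<subseteq> X' \<union> Y' \<and>
        card X' + card Y' = hue_number G 1 + 2"
      using T(1) by (intro exI[of _ ?X] exI[of _ ?Y]) auto
  qed
qed

section \<open>Coronas of complete graphs\<close>

lemma verts_corona: "verts (corona H) = Inl ` verts H \<union> Inr ` verts H"
  by (simp add: corona_def)

lemma dominates_corona [simp]:
  "Inl u \<rightarrow>\<^bsub>corona H\<^esub> Inl v \<longleftrightarrow> u \<rightarrow>\<^bsub>H\<^esub> v"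
  "Inl u \<rightarrow>\<^bsub>corona H\<^esub> Inr v \<longleftrightarrow> u = v \<and> u \<in> verts H"
  "Inr u \<rightarrow>\<^bsub>corona H\<^esub> Inl v \<longleftrightarrow> u = v \<and> u \<in> verts H"
  "\<not> Inr u \<rightarrow>\<^bsub>corona H\<^esub> Inr v"
  by (auto simp: corona_def)

lemma connected_corona:
  assumes "graph H" "connected H"
  shows "connected (corona H)"
proof -
  interpret H: graph H by fact
  interpret C: graph "corona H" by (rule graph_corona) fact
  have sc: "strongly_connected H"
    using H.symmetric_connected_imp_strongly_connected[OF H.sym_arcs assms(2)] .
  have lift: "Inl u \<rightarrow>\<^sup>*\<^bsub>corona H\<^esub> Inl v" if "u \<rightarrow>\<^sup>*\<^bsub>H\<^esub> v" for u v
    using that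
  proof induct
    case base
    then show ?case
      by (auto simp: verts_corona)
  next
    case (step x y)
    then have "Inl x \<rightarrow>\<^bsub>corona H\<^esub> Inl y"
      by simp
    then show ?case
      using step(3) by (rule C.adj_reachable_trans)
  qed
  \<comment> \<open>The case expression is the base vertex of \<open>x\<close>: \<open>x\<close>
    itself if it comes from \<open>H\<close>, and the attachment point if it is a leaf.\<close>
  have leaf: "x \<rightarrow>\<^sup>*\<^bsub>corona H\<^esub> Inl (case x of Inl v \<Rightarrow> v | Inr v \<Rightarrow> v)"
      "Inl (case x of Inl v \<Rightarrow> v | Inr v \<Rightarrow> v) \<rightarrow>\<^sup>*\<^bsub>corona H\<^esub> x"
      "(case x of Inl v \<Rightarrow> v | Inr v \<Rightarrow> v) \<in> verts H"
    if "x \<in> verts (corona H)" for x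
    using that by (auto simp: verts_corona)
  have "x \<rightarrow>\<^sup>*\<^bsub>corona H\<^esub> y" if "x \<in> verts (corona H)" "y \<in> verts (corona H)" for x y
    using leaf[OF that(1)] leaf[OF that(2)] lift sc
    by (meson C.reachable_trans strongly_connectedE)
  moreover have "verts (corona H) \<noteq> {}"
    using sc by (auto simp: strongly_connected_def verts_corona)
  ultimately show ?thesis
    by (intro C.connectedI C.reachable_mk_symmetricI)
qed

context
  fixes a :: nat and K :: "('c, 'd) pre_digraph"
  assumes K: "complete_digraph a K"
begin

lemma graph_complete: "graph K"
  and card_complete: "card (verts K) = a"
  and dominates_complete: "u \<rightarrow>\<^bsub>K\<^esub> v \<longleftrightarrow> u \<in> verts K \<and> v \<in> verts K \<and> u \<noteq> v"
  using K by (auto simp: complete_digraph_def)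

lemma connected_complete:
  assumes "a \<noteq> 0"
  shows "connected K"
proof -
  interpret K: graph K by (rule graph_complete)
  have "u \<rightarrow>\<^sup>*\<^bsub>K\<^esub> v" if "u \<in> verts K" "v \<in> verts K" for u v
    using that dominates_complete[of u v] by (cases "u = v") auto
  then show ?thesis
    using assms card_complete by (intro K.connectedI K.reachable_mk_symmetricI) auto
qed

lemma finite_complete: "finite (verts K)"
proof -
  interpret K: graph K by (rule graph_complete)
  show ?thesis by simp
qed

text \<open>For one color, a maximal set picks exactly one vertex from each pair of a base vertex
  and its leaf. For \<open>k \<ge> 2\<close> every leaf can be added, since it has to avoid one
  color only, and as many clique vertices occur as there are colors for them.\<close>

lemma card_maximal_colorable_corona:
  assumes k: "1 \<le> k" and max: "maximal_colorable_subgraph k (corona K) H"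
  shows "card (verts H) = (if k = 1 then a else a + min k a)"
proof -
  obtain S where S: "S \<subseteq> verts (corona K)" "H = corona K \<restriction> S" "colorable k (corona K \<restriction> S)"
    and S_max: "\<And>v. \<lbrakk>v \<in> verts (corona K); colorable k (corona K \<restriction> insert v S)\<rbrakk> \<Longrightarrow> v \<in> S"
    using maximal_colorableD[OF max] by blast
  define P where "P = {v. Inl v \<in> S}"
  define Q where "Q = {v. Inr v \<in> S}"
  have PQ: "P \<subseteq> verts K" "Q \<subseteq> verts K" and S_eq: "S = Inl ` P \<union> Inr ` Q"
    using S(1) unfolding P_def Q_def verts_corona by auto
  have fin: "finite P" "finite Q"
    using PQ finite_complete finite_subset by auto
  have card_S: "card (verts H) = card P + card Q"
    unfolding S(2) S_eq induce_subgraph_verts using fin by (subst card_Un_disjoint) (auto simp: card_image)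
  obtain c where c: "\<forall>v\<in>S. c v < k" "\<forall>u\<in>S. \<forall>v\<in>S. u \<rightarrow>\<^bsub>corona K\<^esub> v \<longrightarrow> c u \<noteq> c v"
    using S(3) unfolding colorable_induce_iff by blast
  show ?thesis
  proof (cases "k = 1")
    case True
    have "P \<inter> Q = {}"
      using S(3) PQ unfolding True colorable_1_iff P_def Q_def by fastforce
    moreover have "P \<union> Q = verts K"
    proof (rule ccontr)
      assume "P \<union> Q \<noteq> verts K"
      then obtain v where v: "v \<in> verts K" "v \<notin> P" "v \<notin> Q"
        using PQ by blast
      have "colorable k (corona K \<restriction> insert (Inr v) S)"
        using S(3) v unfolding True colorable_1_iff S_eq by auto
      then have "Inr v \<in> S"
        using v by (intro S_max) (auto simp: verts_corona)
      then show False
        using v by (simp add: Q_def)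
    qed
    ultimately show ?thesis
      using True card_S card_Un_disjoint[OF fin] card_complete by simp
  next
    case False
    then have k2: "2 \<le> k"
      using k by simp
    have "Q = verts K"
    proof (rule ccontr)
      assume "Q \<noteq> verts K"
      then obtain v where v: "v \<in> verts K" "v \<notin> Q"
        using PQ by blast
      \<comment> \<open>A color different from that of the only neighbour of the leaf; both 0 and 1
        are available because \<open>k\<close> is at least 2.\<close>
      define d where "d = (if c (Inl v) = 0 then 1 else 0 :: nat)"
      have "colorable k (corona K \<restriction> insert (Inr v) S)"
        unfolding colorable_induce_iff
        using c v k2 unfolding S_eq
        by (intro exI[of _ "c(Inr v := d)"]) (auto simp: d_def)
      then have "Inr v \<in> S"
        using v by (intro S_max) (auto simp: verts_corona)
      then show False
        using v by (simp add: Q_def)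
    qed
    moreover have "card P \<le> k"
    proof -
      have "inj_on (\<lambda>v. c (Inl v)) P"
      proof (rule inj_onI, rule ccontr)
        fix u v assume uv: "u \<in> P" "v \<in> P" "c (Inl u) = c (Inl v)" "u \<noteq> v"
        then have "Inl u \<rightarrow>\<^bsub>corona K\<^esub> Inl v"
          using PQ dominates_complete by auto
        then show False
          using uv c(2) by (auto simp: P_def)
      qed
      moreover have "(\<lambda>v. c (Inl v)) ` P \<subseteq> {..<k}"
        using c(1) by (auto simp: P_def)
      ultimately show ?thesis
        using card_inj_on_le[of _ P "{..<k}"] by simp
    qed
    moreover have "card P \<le> a"
      using card_mono[OF finite_complete PQ(1)] card_complete by simp
    moreover have "\<not> card P < min k a"
    proof
      assume less: "card P < min k a"
      then obtain v where v: "v \<in> verts K" "v \<notin> P"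
        using PQ(1) card_complete by (metis min_less_iff_conj nat_neq_iff subsetI subset_antisym)
      \<comment> \<open>The old coloring is discarded, as the leaf of \<open>v\<close> may block the
        color left for \<open>v\<close>. Numbering the \<open>card P + 1 \<le> k\<close> clique
        vertices colors them afresh, and each leaf takes 0 or 1, whichever differs from its
        base.\<close>
      obtain e where e: "bij_betw e (insert v P) {0..<card (insert v P)}"
        using ex_bij_betw_finite_nat fin(1) by blast
      have ek: "e u < k" if "u \<in> insert v P" for u
        using bij_betwE[OF e] that less v fin(1) by force
      let ?c = "\<lambda>x. case x of Inl u \<Rightarrow> e u | Inr u \<Rightarrow> if e u = 0 then 1 else 0"
      have "colorable k (corona K \<restriction> insert (Inl v) S)"
        unfolding colorable_induce_iff
      proof (intro exI[of _ ?c] conjI ballI impI)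
        fix x assume "x \<in> insert (Inl v) S"
        then show "?c x < k"
          using ek k2 by (auto simp: S_eq split: sum.splits)
      next
        fix x y assume xy: "x \<in> insert (Inl v) S" "y \<in> insert (Inl v) S" "x \<rightarrow>\<^bsub>corona K\<^esub> y"
        show "?c x \<noteq> ?c y"
        proof (cases x; cases y)
          fix u w assume "x = Inl u" "y = Inl w"
          then show ?thesis
            using xy inj_onD[OF bij_betw_imp_inj_on[OF e], of u w]
            by (auto simp: S_eq dominates_complete)
        qed (use xy in auto)
      qed
      then have "Inl v \<in> S"
        using v by (intro S_max) (auto simp: verts_corona)
      then show False
        using v by (simp add: P_def)
    qed
    ultimately show ?thesis
      using False card_S card_complete by (auto simp: min_def)
  qed
qed

lemma corona_complete_hued:
  assumes "2 \<le> a"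
  shows "graph (corona K)" "connected (corona K)" "well_hued (corona K)"
    "hue_number (corona K) 1 = a" "hue_number (corona K) 2 = a + 2"
proof -
  show "graph (corona K)"
    by (rule graph_corona[OF graph_complete])
  then interpret C: graph "corona K" .
  show "connected (corona K)"
    using assms by (intro connected_corona graph_complete connected_complete) auto
  show "well_hued (corona K)"
    unfolding well_hued_def using card_maximal_colorable_corona by auto
  show "hue_number (corona K) 1 = a"
    using card_maximal_colorable_corona[of 1] by (intro C.hue_numberI) auto
  show "hue_number (corona K) 2 = a + 2"
    using card_maximal_colorable_corona[of 2] assms by (intro C.hue_numberI) auto
qed

end

section \<open>Isomorphism with the corona\<close>

text \<open>Arcs of \<open>with_proj H\<close> are pairs of vertices, so a vertex bijection
  determines the arc map. Absence of parallel arcs makes this map injective, and the adjacency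
  equivalence makes its image \<open>parcs H\<close>.\<close>

lemma digraph_iso_with_projI:
  fixes G :: "('a, 'b) pre_digraph" and H :: "'c pair_pre_digraph"
  assumes "nomulti_digraph G" "wf_digraph (with_proj H)"
    and f: "bij_betw f (verts G) (pverts H)"
    and adj: "\<And>u v. \<lbrakk>u \<in> verts G; v \<in> verts G\<rbrakk> \<Longrightarrow> (f u, f v) \<in> parcs H \<longleftrightarrow> u \<rightarrow>\<^bsub>G\<^esub> v"
  shows "digraph_iso G (with_proj H)"
proof -
  interpret G: nomulti_digraph G by fact
  interpret H: wf_digraph "with_proj H" by fact
  define h where "h = \<lparr>iso_verts = f, iso_arcs = (\<lambda>e. (f (tail G e), f (head G e))),
    iso_head = snd, iso_tail = fst\<rparr>"
  have inj: "inj_on f (verts G)" and im: "f ` verts G = pverts H"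
    using f by (auto simp: bij_betw_def)
  have "inj_on (iso_arcs h) (arcs G)"
  proof (rule inj_onI)
    fix e e' assume e: "e \<in> arcs G" "e' \<in> arcs G" "iso_arcs h e = iso_arcs h e'"
    then have "arc_to_ends G e = arc_to_ends G e'"
      using inj_onD[OF inj] by (auto simp: h_def arc_to_ends_def)
    then show "e = e'"
      using e G.no_multi_arcs by blast
  qed
  then have "pre_digraph.digraph_isomorphism G h"
    unfolding G.digraph_isomorphism_def using inj G.wf_digraph_axioms by (simp add: h_def)
  moreover have "iso_arcs h ` arcs G = parcs H"
  proof (intro equalityI subsetI)
    fix x assume "x \<in> iso_arcs h ` arcs G"
    then obtain e where e: "e \<in> arcs G" "x = (f (tail G e), f (head G e))"
      by (auto simp: h_def)
    then have "tail G e \<rightarrow>\<^bsub>G\<^esub> head G e"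
      by (auto simp: arcs_ends_conv)
    then show "x \<in> parcs H"
      using adj e by auto
  next
    fix x assume x: "x \<in> parcs H"
    then have "fst x \<in> f ` verts G" "snd x \<in> f ` verts G"
      using H.tail_in_verts[of x] H.head_in_verts[of x] im by auto
    then obtain u v where uv: "u \<in> verts G" "v \<in> verts G" "x = (f u, f v)"
      by (metis imageE prod.collapse)
    then have "u \<rightarrow>\<^bsub>G\<^esub> v"
      using x adj by simp
    then obtain e where "e \<in> arcs G" "tail G e = u" "head G e = v"
      by (rule reachableE)
    then show "x \<in> iso_arcs h ` arcs G"
      using uv by (auto simp: h_def)
  qed
  then have "with_proj H = app_iso h G"
    unfolding app_iso_def with_proj_def using im by (simp add: h_def)
  ultimately show ?thesis
    unfolding digraph_iso_def by blast
qed

lemma corona_complete_unique: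
  fixes G :: "('a, 'b) pre_digraph" and K :: "('c, 'd) pre_digraph"
  assumes "graph G" "connected G" "well_hued G" "3 \<le> hue_number G 1"
    "hue_number G 2 = hue_number G 1 + 2"
    and K: "complete_digraph (hue_number G 1) K"
  shows "digraph_iso G (corona K)"
proof -
  interpret G: graph G by fact
  interpret T: two_hued "verts G" "\<lambda>u v. u \<rightarrow>\<^bsub>G\<^esub> v" "hue_number G 1"
    using assms by (intro two_hued_graph)
  obtain I f where I: "T.stable I" "card I = hue_number G 1" and f: "bij_betw f I (verts G - I)"
    and pend: "\<And>u v. \<lbrakk>u \<in> I; v \<in> I\<rbrakk> \<Longrightarrow> u \<rightarrow>\<^bsub>G\<^esub> f v \<longleftrightarrow> u = v"
    and clique: "\<And>u v. \<lbrakk>u \<in> I; v \<in> I\<rbrakk> \<Longrightarrow> f u \<rightarrow>\<^bsub>G\<^esub> f v \<longleftrightarrow> u \<noteq> v"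
    by (rule T.corona_structure) blast
  have IV: "I \<subseteq> verts G"
    using I by (simp add: T.stable_def)
  \<comment> \<open>Any bijection serves, as all vertices of a complete graph are
    interchangeable.\<close>
  obtain h where h: "bij_betw h I (verts K)"
    using finite_same_card_bij[OF T.stable_finite[OF I(1)] finite_complete[OF K]]
      I(2) card_complete[OF K] by auto
  define g where "g = inv_into I f"
  have g: "bij_betw g (verts G - I) I"
    unfolding g_def by (rule bij_betw_inv_into[OF f])
  \<comment> \<open>Vertices of \<open>I\<close> become leaves; a clique vertex goes to the base
    vertex of the leaf assigned to its partner \<open>g v\<close> in \<open>I\<close>.\<close>
  define \<phi> where "\<phi> v = (if v \<in> I then Inr (h v) else Inl (h (g v)))" for v
  have fg: "f (g v) = v" "g v \<in> I" if "v \<in> verts G - I" for v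
    using that f bij_betw_inv_into_right bij_betwE[OF g] unfolding g_def by force+
  have "bij_betw \<phi> (I \<union> (verts G - I)) (Inr ` verts K \<union> Inl ` verts K)"
  proof (rule bij_betw_combine)
    have "bij_betw (Inr \<circ> h) I (Inr ` verts K)"
      using h by (rule bij_betw_trans) (simp add: bij_betw_def)
    then show "bij_betw \<phi> I (Inr ` verts K)"
      by (rule bij_betw_cong[THEN iffD1, rotated]) (simp add: \<phi>_def)
    have "bij_betw (Inl \<circ> (h \<circ> g)) (verts G - I) (Inl ` verts K)"
      using bij_betw_trans[OF g h] by (rule bij_betw_trans) (simp add: bij_betw_def)
    then show "bij_betw \<phi> (verts G - I) (Inl ` verts K)"
      by (rule bij_betw_cong[THEN iffD1, rotated]) (simp add: \<phi>_def)
  qed auto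
  then have bij: "bij_betw \<phi> (verts G) (verts (corona K))"
    using IV by (simp add: verts_corona Un_commute Un_absorb1)
  have h_eq: "h u = h v \<longleftrightarrow> u = v" "h u \<in> verts K" if "u \<in> I" "v \<in> I" for u v
    using that bij_betw_imp_inj_on[OF h] bij_betwE[OF h] by (auto dest: inj_onD)
  have adj: "\<phi> u \<rightarrow>\<^bsub>corona K\<^esub> \<phi> v \<longleftrightarrow> u \<rightarrow>\<^bsub>G\<^esub> v" if "u \<in> verts G" "v \<in> verts G" for u v
  proof (cases "u \<in> I"; cases "v \<in> I")
    assume "u \<in> I" "v \<in> I"
    then show ?thesis
      using I by (simp add: \<phi>_def T.stable_def)
  next
    assume uv: "u \<in> I" "v \<notin> I"
    then show ?thesis
      using that fg[of v] pend[of u "g v"] h_eq[of u "g v"] by (simp add: \<phi>_def)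
  next
    assume uv: "u \<notin> I" "v \<in> I"
    then show ?thesis
      using that fg[of u] pend[of v "g u"] h_eq[of "g u" v] T.adj_commute[of u v] by (auto simp: \<phi>_def)
  next
    assume uv: "u \<notin> I" "v \<notin> I"
    then show ?thesis
      using that fg[of u] fg[of v] clique[of "g u" "g v"] h_eq[of "g u" "g v"] h_eq[of "g v" "g u"]
      by (simp add: \<phi>_def dominates_complete[OF K])
  qed
  interpret C: graph "corona K"
    by (rule graph_corona[OF graph_complete[OF K]])
  have "\<exists>H. corona K = with_proj H"
    unfolding corona_def by blast
  then obtain H where H: "corona K = with_proj H"
    by blast
  show ?thesis
    unfolding H
    by (rule digraph_iso_with_projI[where f = \<phi>])
      (use bij adj G.nomulti_digraph C.wf_digraph in \<open>simp_all add: H\<close>)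
qed

theorem theorem2:
  fixes a :: nat and K :: "('c, 'd) pre_digraph"
  assumes "a \<ge> 3" and "complete_digraph a K"
  shows "(graph (corona K) \<and> connected (corona K) \<and> well_hued (corona K) \<and>
            hue_number (corona K) 1 = a \<and>
            hue_number (corona K) 2 = hue_number (corona K) 1 + 2) \<and>
         (\<forall>G :: ('a, 'b) pre_digraph.
            graph G \<and> connected G \<and> well_hued G \<and>
            hue_number G 1 = a \<and> hue_number G 2 = hue_number G 1 + 2 \<longrightarrow>
            digraph_iso G (corona K))"
proof (intro conjI allI impI)
  note corona = corona_complete_hued[OF assms(2)]
  show "graph (corona K)" "connected (corona K)" "well_hued (corona K)" "hue_number (corona K) 1 = a"
    "hue_number (corona K) 2 = hue_number (corona K) 1 + 2"
    using corona assms(1) by simp_all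
next
  fix G :: "('a, 'b) pre_digraph"
  assume "graph G \<and> connected G \<and> well_hued G \<and>
    hue_number G 1 = a \<and> hue_number G 2 = hue_number G 1 + 2"
  then show "digraph_iso G (corona K)"
    using assms by (intro corona_complete_unique) simp_all
qed

end
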